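(* Let $k$ be an algebraically closed field of characteristic zero, let $\mathfrak g$ be a finite-dimensional nilpotent Lie algebra over $k$, and let $(A,\cdot)$ be an LR-structure on $\mathfrak g$. Let $\mathfrak a\subseteq\mathfrak{gl}(A)$ be the (abelian) Lie subalgebra spanned by all $L(x)$, $x\in A$, and let $A=A_1\oplus\cdots\oplus A_s$ be the decomposition of $A$ into the (nonzero) generalized weight spaces $A_i=A_{\alpha_i}(\mathfrak a)$ of the inclusion representation of $\mathfrak a$, with pairwise distinct weights $\alpha_i\in\mathrm{Hom}(\mathfrak a,k)$. For each $i$ let $e_{i,1},\dots,e_{i,n_i}$ be a basis of $A_i$ in which every $L(z)|_{A_i}$, $z\in A$, is upper triangular (with all diagonal entries equal to $\alpha_i(L(z))$), and put $A_{i,n_i-1}=\mathrm{span}(e_{i,1},\dots,e_{i,n_i-1})$. Write $x\in A$ as $x=x_1+\dots+x_s$ with $x_j\in A_j$. If $x_i\in A_{i,n_i-1}$ for some $i$, then $\alpha_i(L(x))=0$.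
   Context: An LR-algebra is a vector space $A$ with a bilinear product $\cdot$ satisfying $x\cdot(y\cdot z)=y\cdot(x\cdot z)$ and $(x\cdot y)\cdot z=(x\cdot z)\cdot y$ for all $x,y,z\in A$. An LR-structure on a Lie algebra $\mathfrak g$ is an LR-algebra product on the underlying vector space of $\mathfrak g$ such that $x\cdot y-y\cdot x=[x,y]$. $L(x)y=x\cdot y$, $R(x)y=y\cdot x$; the operators $L(x)$ pairwise commute in an LR-algebra. *)

theory Defs
  imports "HOL-Analysis.Analysis" "HOL-Library.Function_Algebras"
    "HOL-Computational_Algebra.Polynomial"
begin

text \<open>The finite-dimensional vector space A over k is modelled as k^n (type 'k^'n);
  a product on A is a function prod :: 'k^'n => 'k^'n => 'k^'n.\<close>

definition bilinear_prod :: "('k::field^'n \<Rightarrow> 'k^'n \<Rightarrow> 'k^'n) \<Rightarrow> bool" where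
  "bilinear_prod p \<longleftrightarrow>
     (\<forall>x. Vector_Spaces.linear (*s) (*s) (p x)) \<and>
     (\<forall>y. Vector_Spaces.linear (*s) (*s) (\<lambda>x. p x y))"

definition LR_algebra :: "('k::field^'n \<Rightarrow> 'k^'n \<Rightarrow> 'k^'n) \<Rightarrow> bool" where
  "LR_algebra p \<longleftrightarrow> bilinear_prod p \<and>
     (\<forall>x y z. p x (p y z) = p y (p x z)) \<and>
     (\<forall>x y z. p (p x y) z = p (p x z) y)"

text \<open>The Lie algebra g underlying an LR-structure p: bracket [x,y] = x.y - y.x.\<close>
definition lie_br :: "('k::field^'n \<Rightarrow> 'k^'n \<Rightarrow> 'k^'n) \<Rightarrow> 'k^'n \<Rightarrow> 'k^'n \<Rightarrow> 'k^'n" where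
  "lie_br p x y = p x y - p y x"

text \<open>Lower central series g^1 = g, g^(m+1) = [g, g^m]; nilpotent iff some term is 0.\<close>
fun lower_central :: "('k::field^'n \<Rightarrow> 'k^'n \<Rightarrow> 'k^'n) \<Rightarrow> nat \<Rightarrow> ('k^'n) set" where
  "lower_central p 0 = UNIV"
| "lower_central p (Suc m) = vec.span {lie_br p x y | x y. y \<in> lower_central p m}"

definition nilpotent_lie :: "('k::field^'n \<Rightarrow> 'k^'n \<Rightarrow> 'k^'n) \<Rightarrow> bool" where
  "nilpotent_lie p \<longleftrightarrow> (\<exists>m. lower_central p m = {0})"

text \<open>Left multiplication operator L(x).\<close>
definition Lop :: "('k::field^'n \<Rightarrow> 'k^'n \<Rightarrow> 'k^'n) \<Rightarrow> 'k^'n \<Rightarrow> ('k^'n \<Rightarrow> 'k^'n)" where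
  "Lop p x = (\<lambda>y. p x y)"

text \<open>Scalar multiplication on endomorphisms gl(A).\<close>
definition fscale :: "'k::field \<Rightarrow> ('k^'n \<Rightarrow> 'k^'n) \<Rightarrow> ('k^'n \<Rightarrow> 'k^'n)" where
  "fscale c f = (\<lambda>v. c *s f v)"

text \<open>The subalgebra a of gl(A) spanned by all L(x).\<close>
definition Lspan :: "('k::field^'n \<Rightarrow> 'k^'n \<Rightarrow> 'k^'n) \<Rightarrow> ('k^'n \<Rightarrow> 'k^'n) set" where
  "Lspan p = module.span fscale (range (Lop p))"

text \<open>alpha : a -> k linear (values outside a are irrelevant).\<close>
definition lin_functional_on :: "('k::field^'n \<Rightarrow> 'k^'n) set \<Rightarrow> (('k^'n \<Rightarrow> 'k^'n) \<Rightarrow> 'k) \<Rightarrow> bool" where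
  "lin_functional_on S \<alpha> \<longleftrightarrow>
     (\<forall>f\<in>S. \<forall>g\<in>S. \<alpha> (f + g) = \<alpha> f + \<alpha> g) \<and>
     (\<forall>c. \<forall>f\<in>S. \<alpha> (fscale c f) = c * \<alpha> f)"

text \<open>Generalized weight space A_alpha(a) of the inclusion representation of a on A.\<close>
definition gen_weight_space :: "('k::field^'n \<Rightarrow> 'k^'n \<Rightarrow> 'k^'n) \<Rightarrow> (('k^'n \<Rightarrow> 'k^'n) \<Rightarrow> 'k) \<Rightarrow> ('k^'n) set" where
  "gen_weight_space p \<alpha> =
     {v. \<forall>a\<in>Lspan p. \<exists>N. ((\<lambda>w. a w - \<alpha> a *s w) ^^ N) v = 0}"

text \<open>A weight: a linear functional on a with nonzero generalized weight space.\<close>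
definition is_weight :: "('k::field^'n \<Rightarrow> 'k^'n \<Rightarrow> 'k^'n) \<Rightarrow> (('k^'n \<Rightarrow> 'k^'n) \<Rightarrow> 'k) \<Rightarrow> bool" where
  "is_weight p \<alpha> \<longleftrightarrow> lin_functional_on (Lspan p) \<alpha> \<and> gen_weight_space p \<alpha> \<noteq> {0}"

end

theory Submission
  imports Defs
begin

text \<open>
  Proof idea.  Let \<open>A\<^sub>\<alpha>\<close> have the triangular basis \<open>e\<^sub>0, \<dots>, e\<^sub>m\<^sub>-\<^sub>1\<close>, let
  \<open>U = span(e\<^sub>0, \<dots>, e\<^sub>m\<^sub>-\<^sub>2)\<close> and let \<open>V\<close> be the subspace generated by \<open>U\<close> and the
  generalized weight spaces \<open>A\<^sub>\<beta>\<close> of the other weights \<open>\<beta> \<noteq> \<alpha>\<close>.  Then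
  \<^item> every operator of \<open>\<aa> = span L(A)\<close> acts on the top vector \<open>e = e\<^sub>m\<^sub>-\<^sub>1\<close> as the
    scalar \<open>\<alpha>\<close> modulo \<open>U\<close>, and consequently \<open>e \<notin> V\<close> (the weights are separated);
  \<^item> \<open>ad(x) = L(x) - R(x)\<close> maps \<open>V\<close> into itself and \<open>ad(x) e \<equiv> \<alpha>(L(x)) e\<close> modulo \<open>V\<close>:
    \<open>L(x)\<close> commutes with \<open>\<aa>\<close>, and \<open>R(x) v = L(v) x\<close> lies in \<open>V\<close> because the
    \<open>A\<^sub>\<alpha>\<close>-component of \<open>x\<close> lies in \<open>U\<close>;
  \<^item> \<open>ad(x)\<close> is nilpotent since the Lie algebra is nilpotent.
  A nilpotent operator that acts on \<open>e\<close> as a scalar modulo an invariant subspace not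
  containing \<open>e\<close> must act by the scalar 0, hence \<open>\<alpha>(L(x)) = 0\<close>.
\<close>

subsection \<open>Linear maps and their iterates\<close>

abbreviation lin :: "('k::field^'n \<Rightarrow> 'k^'n) \<Rightarrow> bool" where
  "lin f \<equiv> Vector_Spaces.linear (*s) (*s) f"

lemma lin_funpow: "lin f \<Longrightarrow> lin (f ^^ k)"
  by (induction k) (auto intro: Vector_Spaces.linear_compose simp: vec.linear_id)

lemma lin_shift: "lin f \<Longrightarrow> lin (\<lambda>v. f v - c *s v)"
  by (intro vec.linear_compose_sub vec.linear_scale_self)

lemma funpow_invariant: "(\<forall>v\<in>V. f v \<in> V) \<Longrightarrow> v \<in> V \<Longrightarrow> (f ^^ k) v \<in> V"
  by (induction k) auto

lemma funpow_commute: "(\<And>y. f (g y) = g (f y)) \<Longrightarrow> (f ^^ k) (g y) = g ((f ^^ k) y)"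
  by (induction k) auto

text \<open>A vector killed by a power of a linear map is killed by every higher power.\<close>

lemma funpow_kill_mono:
  assumes "lin f" "(f ^^ N) v = 0" "N \<le> M"
  shows "(f ^^ M) v = 0"
proof -
  have "(f ^^ M) v = (f ^^ (M - N)) ((f ^^ N) v)"
    using assms(3) by (metis funpow_add comp_apply le_add_diff_inverse2)
  then show ?thesis
    using assms(2) vec.linear_0[OF lin_funpow[OF assms(1)]] by simp
qed

text \<open>A linear map sending generators into a span sends their whole span there.\<close>

lemma lin_image_span:
  assumes "lin f" "\<forall>s\<in>S. f s \<in> vec.span T" "v \<in> vec.span S"
  shows "f v \<in> vec.span T"
proof -
  have "f v \<in> vec.span (f ` S)"
    using assms(1,3) by (simp add: vec.linear_span_image)
  also have "\<dots> \<subseteq> vec.span T"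
    using assms(2) by (intro vec.span_minimal) auto
  finally show ?thesis .
qed

text \<open>The key linear-algebra fact: if \<open>T\<close> preserves a subspace \<open>V\<close>, acts on a vector
  \<open>e \<notin> V\<close> as the scalar \<open>d\<close> modulo \<open>V\<close>, and some power of \<open>T\<close> maps \<open>e\<close> into \<open>V\<close>,
  then \<open>d = 0\<close>.  (Indeed \<open>T\<^sup>k e \<equiv> d\<^sup>k e\<close> modulo \<open>V\<close>.)\<close>

lemma eigenvalue_mod_invariant_subspace:
  assumes T: "lin T" and V: "vec.subspace V" and inv: "\<forall>v\<in>V. T v \<in> V"
    and eig: "T e - d *s e \<in> V" and pow: "(T ^^ k) e \<in> V" and e: "e \<notin> V"
  shows "d = 0"
proof -
  have powers: "(T ^^ j) e - d ^ j *s e \<in> V" for j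
  proof (induction j)
    case 0
    show ?case using vec.subspace_0[OF V] by simp
  next
    case (Suc j)
    have "(T ^^ Suc j) e - d ^ Suc j *s e
        = T ((T ^^ j) e - d ^ j *s e) + d ^ j *s (T e - d *s e)"
      using T by (simp add: vec.linear_diff vec.linear_scale vec.scale_right_diff_distrib
          mult.commute)
    also have "\<dots> \<in> V"
      using Suc inv eig V by (intro vec.subspace_add vec.subspace_scale) auto
    finally show ?case .
  qed
  have dk: "d ^ k *s e \<in> V"
    using vec.subspace_diff[OF V pow powers[of k]] by simp
  show ?thesis
  proof (rule ccontr)
    assume "d \<noteq> 0"
    then have "e = inverse (d ^ k) *s (d ^ k *s e)" by simp
    also have "\<dots> \<in> V" using V dk by (rule vec.subspace_scale)
    finally show False using e by contradiction
  qed
qed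

subsection \<open>The operator space spanned by left multiplications\<close>

lemma module_fscale: "module (fscale :: 'k::field \<Rightarrow> ('k^'n \<Rightarrow> 'k^'n) \<Rightarrow> _)"
  by unfold_locales
    (auto simp: fscale_def plus_fun_def fun_eq_iff vec.scale_right_distrib vec.scale_left_distrib)

text \<open>Induction over \<open>Lspan p\<close>: a property of all \<open>L(z)\<close> closed under the linear operations
  holds on the whole operator space.\<close>

lemma Lspan_induct [consumes 1, case_names zero Lop add scale]:
  assumes "a \<in> Lspan p" "P 0" "\<And>z. P (Lop p z)" "\<And>f g. P f \<Longrightarrow> P g \<Longrightarrow> P (f + g)"
    "\<And>c f. P f \<Longrightarrow> P (fscale c f)"
  shows "P a"
  by (rule module.span_induct_alt[OF module_fscale, of a "range (Lop p)" P])
    (use assms in \<open>auto simp: Lspan_def\<close>)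

lemma Lop_in_Lspan: "Lop p z \<in> Lspan p"
  unfolding Lspan_def by (rule module.span_base[OF module_fscale]) simp

subsection \<open>Generalized weight spaces\<close>

text \<open>A linear map commuting with all of \<open>Lspan p\<close> preserves every generalized weight space.\<close>

lemma gen_weight_space_invariant:
  assumes S: "lin S" and comm: "\<forall>b\<in>Lspan p. \<forall>y. S (b y) = b (S y)"
    and v: "v \<in> gen_weight_space p \<beta>"
  shows "S v \<in> gen_weight_space p \<beta>"
  unfolding gen_weight_space_def
proof (intro CollectI ballI)
  fix b assume b: "b \<in> Lspan p"
  obtain N where N: "((\<lambda>w. b w - \<beta> b *s w) ^^ N) v = 0"
    using v b unfolding gen_weight_space_def by blast
  have "((\<lambda>w. b w - \<beta> b *s w) ^^ N) (S v) = S (((\<lambda>w. b w - \<beta> b *s w) ^^ N) v)"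
    by (rule funpow_commute) (use S comm b in \<open>simp add: vec.linear_diff vec.linear_scale\<close>)
  with N show "\<exists>N. ((\<lambda>w. b w - \<beta> b *s w) ^^ N) (S v) = 0"
    using vec.linear_0[OF S] by auto
qed

text \<open>The subspace generated by a subspace \<open>U\<close> and the generalized weight spaces of the
  weights in \<open>F\<close>.  For \<open>U = span(e\<^sub>0, \<dots>, e\<^sub>m\<^sub>-\<^sub>2)\<close> and \<open>F\<close> the weights other than \<open>\<alpha>\<close> it is
  the subspace \<open>V\<close> of the proof idea, which will be shown to miss the top vector of \<open>A\<^sub>\<alpha>\<close>.\<close>

definition weight_span ::
    "('k::field^'n \<Rightarrow> 'k^'n \<Rightarrow> 'k^'n) \<Rightarrow> ('k^'n) set \<Rightarrow> (('k^'n \<Rightarrow> 'k^'n) \<Rightarrow> 'k) set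
      \<Rightarrow> ('k^'n) set"
  where "weight_span p U F = vec.span (U \<union> \<Union>(gen_weight_space p ` F))"

lemma weight_span_subspace: "vec.subspace (weight_span p U F)"
  unfolding weight_span_def by simp

lemma weight_span_superset: "U \<subseteq> weight_span p U F"
  unfolding weight_span_def by (auto intro: vec.span_base)

lemma gen_weight_space_subset_weight_span:
  "\<beta> \<in> F \<Longrightarrow> gen_weight_space p \<beta> \<subseteq> weight_span p U F"
  unfolding weight_span_def by (auto intro: vec.span_base)

lemma weight_span_empty: "vec.subspace U \<Longrightarrow> weight_span p U {} = U"
  unfolding weight_span_def by simp

text \<open>Maps commuting with \<open>Lspan p\<close> and preserving \<open>U\<close> preserve \<open>weight_span p U F\<close>.\<close>

lemma weight_span_invariant:
  assumes S: "lin S" and comm: "\<forall>b\<in>Lspan p. \<forall>y. S (b y) = b (S y)"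
    and U: "\<forall>u\<in>U. S u \<in> U" and v: "v \<in> weight_span p U F"
  shows "S v \<in> weight_span p U F"
  using S _ v unfolding weight_span_def
proof (rule lin_image_span)
  show "\<forall>s\<in>U \<union> \<Union>(gen_weight_space p ` F).
      S s \<in> vec.span (U \<union> \<Union>(gen_weight_space p ` F))"
    using U gen_weight_space_invariant[OF S comm] by (fastforce intro: vec.span_base)
qed

subsection \<open>Nilpotency of inner derivations\<close>

lemma ad_power_lower_central: "(lie_br p x ^^ k) y \<in> lower_central p k"
proof (induction k)
  case 0
  show ?case by simp
next
  case (Suc k)
  have "(lie_br p x ^^ Suc k) y = lie_br p x ((lie_br p x ^^ k) y)" by simp
  also have "\<dots> \<in> vec.span {lie_br p x y |x y. y \<in> lower_central p k}"
    using Suc by (intro vec.span_base) blast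
  finally show ?case by simp
qed

lemma nilpotent_ad:
  assumes "nilpotent_lie p"
  obtains M where "\<And>y. (lie_br p x ^^ M) y = 0"
  using assms ad_power_lower_central unfolding nilpotent_lie_def by blast

subsection \<open>Triangular bases\<close>

lemma lessThan_last:
  assumes "0 < (m::nat)"
  shows "{..<m} = insert (m - 1) {..<m - 1}"
proof -
  have "Suc (m - 1) = m" using assms by simp
  then show ?thesis using lessThan_Suc[of "m - 1"] by simp
qed

text \<open>The last vector of a basis is not in the span of the others.\<close>

lemma last_vector_not_in_span:
  fixes e :: "nat \<Rightarrow> 'k::field^'n" and m :: nat
  assumes ind: "vec.independent (e ` {..<m})" and inj: "inj_on e {..<m}" and m: "0 < m"
  shows "e (m - 1) \<notin> vec.span (e ` {..<m - 1})"
proof -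
  have split: "{..<m} = insert (m - 1) {..<m - 1}"
    using m by (rule lessThan_last)
  have "e (m - 1) \<notin> e ` {..<m - 1}"
  proof
    assume "e (m - 1) \<in> e ` {..<m - 1}"
    then obtain j where j: "j < m - 1" "e (m - 1) = e j" by auto
    then have "m - 1 = j" using m by (intro inj_onD[OF inj]) auto
    with j(1) show False by simp
  qed
  with ind show ?thesis
    unfolding split by (simp add: vec.independent_insert)
qed

text \<open>A linear map that is upper triangular in the basis \<open>e\<close> preserves every initial
  segment \<open>span(e\<^sub>0, \<dots>, e\<^sub>l\<^sub>-\<^sub>1)\<close> of the flag.\<close>

lemma triangular_flag_invariant:
  fixes m l :: nat
  assumes f: "lin f" and tri: "\<forall>j<m. f (e j) \<in> vec.span (e ` {..j})"
    and l: "l \<le> m" and v: "v \<in> vec.span (e ` {..<l})"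
  shows "f v \<in> vec.span (e ` {..<l})"
  using f _ v
proof (rule lin_image_span)
  show "\<forall>s\<in>e ` {..<l}. f s \<in> vec.span (e ` {..<l})"
  proof
    fix s assume "s \<in> e ` {..<l}"
    then obtain j where j: "j < l" "s = e j" by auto
    have "j < m" using j l by simp
    then have "f s \<in> vec.span (e ` {..j})" using tri j by simp
    also have "\<dots> \<subseteq> vec.span (e ` {..<l})"
      using j by (intro vec.span_mono image_mono) auto
    finally show "f s \<in> vec.span (e ` {..<l})" .
  qed
qed

subsection \<open>Left-commutative algebras\<close>

text \<open>A bilinear product with \<open>x(yz) = y(xz)\<close>, i.e. with pairwise commuting left
  multiplications.  Every LR-algebra is one.\<close>

locale left_commutative_algebra =
  fixes p :: "'k::field^'n \<Rightarrow> 'k^'n \<Rightarrow> 'k^'n"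
  assumes bilinear: "bilinear_prod p"
    and left_commute: "p x (p y z) = p y (p x z)"
begin

lemma left_linear: "lin (p z)"
  using bilinear unfolding bilinear_prod_def by blast

lemma right_linear: "lin (\<lambda>x. p x y)"
  using bilinear unfolding bilinear_prod_def by blast

lemma lie_br_linear: "lin (lie_br p x)"
  unfolding lie_br_def by (intro vec.linear_compose_sub left_linear right_linear)

lemma Lspan_linear: "a \<in> Lspan p \<Longrightarrow> lin a"
proof (induction rule: Lspan_induct)
  case zero
  show ?case unfolding zero_fun_def by (rule vec.linear_zero)
next
  case (Lop z)
  show ?case unfolding Lop_def by (rule left_linear)
next
  case (add f g)
  then show ?case unfolding plus_fun_def by (rule vec.linear_compose_add)
next
  case (scale c f)
  then show ?case unfolding fscale_def by (rule vec.linear_compose_scale_right)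
qed

text \<open>Every operator in \<open>Lspan p\<close> commutes with all left multiplications, hence
  \<open>Lspan p\<close> is a commutative family of operators.\<close>

lemma Lspan_commute_Lop: "a \<in> Lspan p \<Longrightarrow> a (p z y) = p z (a y)"
  by (induction rule: Lspan_induct)
    (auto simp: Lop_def left_commute fscale_def vec.linear_0[OF left_linear]
      vec.linear_add[OF left_linear] vec.linear_scale[OF left_linear])

lemma Lspan_commute:
  assumes a: "a \<in> Lspan p" and b: "b \<in> Lspan p"
  shows "a (b y) = b (a y)"
  using b
proof (induction rule: Lspan_induct)
  case zero
  show ?case using vec.linear_0[OF Lspan_linear[OF a]] by simp
next
  case (Lop z)
  show ?case unfolding Lop_def by (rule Lspan_commute_Lop[OF a])
next
  case (add f g)
  then show ?case using vec.linear_add[OF Lspan_linear[OF a]] by simp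
next
  case (scale c f)
  then show ?case using vec.linear_scale[OF Lspan_linear[OF a]] by (simp add: fscale_def)
qed

text \<open>A subspace stable under all \<open>L(z)\<close> is stable under all of \<open>Lspan p\<close>.\<close>

lemma Lspan_invariant_subspace:
  assumes "vec.subspace S" "\<forall>z. \<forall>u\<in>S. p z u \<in> S" "a \<in> Lspan p" "u \<in> S"
  shows "a u \<in> S"
  using assms(3)
  by (induction rule: Lspan_induct)
    (use assms in \<open>auto simp: Lop_def fscale_def vec.subspace_0 vec.subspace_add
      vec.subspace_scale\<close>)

text \<open>If \<open>U\<close> is \<open>Lspan p\<close>-stable, then every shifted operator \<open>a - c\<close> with \<open>a \<in> Lspan p\<close>
  preserves \<open>weight_span p U F\<close>.\<close>

lemma shifted_Lspan_weight_span_invariant: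
  assumes U: "vec.subspace U" and U_inv: "\<forall>a\<in>Lspan p. \<forall>u\<in>U. a u \<in> U" and a: "a \<in> Lspan p"
  shows "\<forall>v\<in>weight_span p U F. a v - c *s v \<in> weight_span p U F"
proof
  fix v assume v: "v \<in> weight_span p U F"
  have comm: "\<forall>b\<in>Lspan p. \<forall>y. a (b y) - c *s b y = b (a y - c *s y)"
    using Lspan_commute[OF a] Lspan_linear by (simp add: vec.linear_diff vec.linear_scale)
  have "\<forall>u\<in>U. a u - c *s u \<in> U"
    using U U_inv a by (auto intro: vec.subspace_diff vec.subspace_scale)
  with v show "a v - c *s v \<in> weight_span p U F"
    using weight_span_invariant[OF lin_shift[OF Lspan_linear[OF a]] comm] by blast
qed

lemma gen_weight_space_subspace: "vec.subspace (gen_weight_space p \<beta>)"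
  unfolding vec.subspace_def
proof (intro conjI ballI allI)
  show "0 \<in> gen_weight_space p \<beta>"
    unfolding gen_weight_space_def by (auto intro: exI[of _ 0])
next
  fix v w assume v: "v \<in> gen_weight_space p \<beta>" and w: "w \<in> gen_weight_space p \<beta>"
  show "v + w \<in> gen_weight_space p \<beta>"
    unfolding gen_weight_space_def
  proof (intro CollectI ballI)
    fix b assume b: "b \<in> Lspan p"
    define T where "T = (\<lambda>u. b u - \<beta> b *s u)"
    have T: "lin T" unfolding T_def by (rule lin_shift[OF Lspan_linear[OF b]])
    obtain N M where "(T ^^ N) v = 0" "(T ^^ M) w = 0"
      using v w b unfolding gen_weight_space_def T_def by blast
    then have "(T ^^ (N + M)) v = 0" "(T ^^ (N + M)) w = 0"
      using funpow_kill_mono[OF T] by auto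
    then have "(T ^^ (N + M)) (v + w) = 0"
      using vec.linear_add[OF lin_funpow[OF T]] by simp
    then show "\<exists>K. ((\<lambda>u. b u - \<beta> b *s u) ^^ K) (v + w) = 0"
      unfolding T_def by blast
  qed
next
  fix c v assume v: "v \<in> gen_weight_space p \<beta>"
  have "\<forall>b\<in>Lspan p. \<forall>y. c *s b y = b (c *s y)"
    using Lspan_linear by (simp add: vec.linear_scale)
  then show "c *s v \<in> gen_weight_space p \<beta>"
    using v by (rule gen_weight_space_invariant[OF vec.linear_scale_self])
qed

text \<open>Peeling off one generalized weight space from a \<open>weight_span\<close>.\<close>

lemma weight_span_insert_decompose:
  assumes "v \<in> weight_span p U (insert \<gamma> F)"
  obtains s y where "s \<in> weight_span p U F" "y \<in> gen_weight_space p \<gamma>" "v = s + y"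
proof -
  have "v \<in> vec.span ((U \<union> \<Union>(gen_weight_space p ` F)) \<union> gen_weight_space p \<gamma>)"
    using assms unfolding weight_span_def by (simp add: Un_ac)
  then obtain s y where "s \<in> weight_span p U F" "y \<in> vec.span (gen_weight_space p \<gamma>)" "v = s + y"
    unfolding vec.span_Un weight_span_def by blast
  then show ?thesis
    using that vec.span_eq_iff[THEN iffD2, OF gen_weight_space_subspace] by metis
qed

text \<open>Let \<open>U\<close> be an \<open>a\<close>-stable subspace with \<open>e \<notin> U\<close> and \<open>A\<^sub>\<alpha> \<subseteq> span(e, U)\<close>, where
  \<open>e \<in> A\<^sub>\<alpha>\<close>.  Then \<open>a\<close> acts on \<open>e\<close> by \<open>\<alpha>(a)\<close> modulo \<open>U\<close>: it acts by some scalar \<open>k\<close> since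
  \<open>a e \<in> A\<^sub>\<alpha>\<close>, and \<open>k = \<alpha>(a)\<close> because \<open>a - \<alpha>(a)\<close> is nilpotent on \<open>e\<close>.\<close>

lemma top_vector_weight:
  assumes U: "vec.subspace U" and U_inv: "\<forall>u\<in>U. a u \<in> U" and a: "a \<in> Lspan p"
    and e: "e \<notin> U" "e \<in> gen_weight_space p \<alpha>"
    and top: "gen_weight_space p \<alpha> \<subseteq> vec.span (insert e U)"
  shows "a e - \<alpha> a *s e \<in> U"
proof -
  define T where "T = (\<lambda>v. a v - \<alpha> a *s v)"
  have "a e \<in> gen_weight_space p \<alpha>"
    using gen_weight_space_invariant[OF Lspan_linear[OF a] _ e(2)] Lspan_commute[OF a] by blast
  then have "a e \<in> vec.span (insert e U)"
    using top by blast
  then obtain k where k: "a e - k *s e \<in> U"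
    unfolding vec.span_breakdown_eq vec.span_eq_iff[THEN iffD2, OF U] by blast
  obtain N where N: "(T ^^ N) e = 0"
    using e(2) a unfolding gen_weight_space_def T_def by blast
  have "k - \<alpha> a = 0"
  proof (rule eigenvalue_mod_invariant_subspace[of T U])
    show "lin T" unfolding T_def by (rule lin_shift[OF Lspan_linear[OF a]])
    show "\<forall>v\<in>U. T v \<in> U"
      using U U_inv unfolding T_def by (auto intro: vec.subspace_diff vec.subspace_scale)
    show "T e - (k - \<alpha> a) *s e \<in> U"
      using k unfolding T_def by (simp add: vec.scale_left_diff_distrib)
    show "(T ^^ N) e \<in> U" using N U by (simp add: vec.subspace_0)
  qed fact+
  with k show ?thesis by simp
qed

text \<open>A vector on which \<open>Lspan p\<close> acts by \<open>\<alpha>\<close> modulo \<open>U\<close> does not lie in the span of \<open>U\<close>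
  and the generalized weight spaces of weights separated from \<open>\<alpha>\<close>.  Induction on the set
  of weights: to remove \<open>A\<^sub>\<gamma>\<close>, apply a power of \<open>a - \<gamma>(a)\<close> with \<open>\<alpha>(a) \<noteq> \<gamma>(a)\<close>, which
  kills \<open>A\<^sub>\<gamma>\<close> but acts on \<open>e\<close> by the nonzero scalar \<open>\<alpha>(a) - \<gamma>(a)\<close>.\<close>

lemma top_vector_not_in_weight_span:
  assumes U: "vec.subspace U" and U_inv: "\<forall>a\<in>Lspan p. \<forall>u\<in>U. a u \<in> U" and e: "e \<notin> U"
    and top: "\<forall>a\<in>Lspan p. a e - \<alpha> a *s e \<in> U"
    and F: "finite F" and sep: "\<forall>\<gamma>\<in>F. \<exists>a\<in>Lspan p. \<alpha> a \<noteq> \<gamma> a"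
  shows "e \<notin> weight_span p U F"
  using F sep
proof (induction F rule: finite_induct)
  case empty
  show ?case using e weight_span_empty[OF U] by simp
next
  case (insert \<gamma> F)
  define V where "V = weight_span p U F"
  obtain a where a: "a \<in> Lspan p" "\<alpha> a \<noteq> \<gamma> a"
    using insert.prems by auto
  define T where "T = (\<lambda>v. a v - \<gamma> a *s v)"
  have T: "lin T" unfolding T_def by (rule lin_shift[OF Lspan_linear[OF a(1)]])
  have T_V: "\<forall>v\<in>V. T v \<in> V"
    unfolding V_def T_def by (rule shifted_Lspan_weight_span_invariant[OF U U_inv a(1)])
  show ?case
  proof
    assume "e \<in> weight_span p U (insert \<gamma> F)"
    then obtain s y where s: "s \<in> V" and y: "y \<in> gen_weight_space p \<gamma>" and e_sy: "e = s + y"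
      unfolding V_def by (rule weight_span_insert_decompose)
    obtain N where N: "(T ^^ N) y = 0"
      using y a(1) unfolding gen_weight_space_def T_def by blast
    have "\<alpha> a - \<gamma> a = 0"
    proof (rule eigenvalue_mod_invariant_subspace[OF T _ T_V])
      show "vec.subspace V" unfolding V_def by (rule weight_span_subspace)
      show "(T ^^ N) e \<in> V"
        using funpow_invariant[OF T_V s] N vec.linear_add[OF lin_funpow[OF T]] e_sy by simp
      have "T e - (\<alpha> a - \<gamma> a) *s e = a e - \<alpha> a *s e"
        unfolding T_def by (simp add: vec.scale_left_diff_distrib)
      also have "\<dots> \<in> V"
        using top a(1) weight_span_superset[of U p F] unfolding V_def by blast
      finally show "T e - (\<alpha> a - \<gamma> a) *s e \<in> V" .
      show "e \<notin> V" using insert.IH insert.prems unfolding V_def by simp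
    qed
    with a(2) show False by simp
  qed
qed

text \<open>For a triangular basis \<open>e\<^sub>0, \<dots>, e\<^sub>m\<^sub>-\<^sub>1\<close> of \<open>A\<^sub>\<alpha>\<close>, the hyperplane
  \<open>U = span(e\<^sub>0, \<dots>, e\<^sub>m\<^sub>-\<^sub>2)\<close> is \<open>Lspan p\<close>-stable, misses the top vector \<open>e\<^sub>m\<^sub>-\<^sub>1\<close>, and
  \<open>Lspan p\<close> acts on \<open>e\<^sub>m\<^sub>-\<^sub>1\<close> by the weight \<open>\<alpha>\<close> modulo \<open>U\<close>.\<close>

lemma last_basis_vector_weight:
  fixes e :: "nat \<Rightarrow> 'k^'n" and m :: nat
  assumes ind: "vec.independent (e ` {..<m})" and inj: "inj_on e {..<m}" and m: "0 < m"
    and span: "vec.span (e ` {..<m}) = gen_weight_space p \<alpha>"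
    and tri: "\<forall>z. \<forall>j<m. Lop p z (e j) \<in> vec.span (e ` {..j})"
  defines "U \<equiv> vec.span (e ` {..<m - 1})"
  shows "e (m - 1) \<notin> U" and "\<forall>a\<in>Lspan p. \<forall>u\<in>U. a u \<in> U"
    and "\<forall>a\<in>Lspan p. a (e (m - 1)) - \<alpha> a *s e (m - 1) \<in> U"
proof -
  have U: "vec.subspace U" unfolding U_def by simp
  show e_U: "e (m - 1) \<notin> U"
    unfolding U_def by (rule last_vector_not_in_span[OF ind inj m])
  have "\<forall>z. \<forall>u\<in>U. p z u \<in> U"
  proof (intro allI ballI)
    fix z u assume u: "u \<in> U"
    show "p z u \<in> U"
      unfolding U_def
    proof (rule triangular_flag_invariant[OF left_linear])
      show "\<forall>j<m. p z (e j) \<in> vec.span (e ` {..j})" using tri unfolding Lop_def by simp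
      show "u \<in> vec.span (e ` {..<m - 1})" using u unfolding U_def .
    qed simp
  qed
  then show U_inv: "\<forall>a\<in>Lspan p. \<forall>u\<in>U. a u \<in> U"
    using Lspan_invariant_subspace[OF U] by blast
  have split: "e ` {..<m} = insert (e (m - 1)) (e ` {..<m - 1})"
    using lessThan_last[OF m] by simp
  have e_weight: "e (m - 1) \<in> gen_weight_space p \<alpha>"
    unfolding span[symmetric] split by (rule vec.span_base) simp
  have weight_top: "gen_weight_space p \<alpha> \<subseteq> vec.span (insert (e (m - 1)) U)"
    unfolding span[symmetric] split U_def by (intro vec.span_mono) (auto intro: vec.span_base)
  show "\<forall>a\<in>Lspan p. a (e (m - 1)) - \<alpha> a *s e (m - 1) \<in> U"
  proof
    fix a assume a: "a \<in> Lspan p"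
    show "a (e (m - 1)) - \<alpha> a *s e (m - 1) \<in> U"
      using U_inv a by (intro top_vector_weight[OF U _ a e_U e_weight weight_top]) blast
  qed
qed

text \<open>If the \<open>A\<^sub>\<alpha>\<close>-component of \<open>x\<close> lies in \<open>U\<close>, then \<open>ad(x) = L(x) - R(x)\<close> preserves
  \<open>V = weight_span p U (W - {\<alpha>})\<close> and acts on \<open>e\<close> by \<open>\<alpha>(L(x))\<close> modulo \<open>V\<close>.  The point is
  that \<open>R(x) v = L(v) x\<close> lies in \<open>V\<close> for every \<open>v\<close>.\<close>

lemma ad_on_weight_span:
  assumes U: "vec.subspace U" and U_inv: "\<forall>a\<in>Lspan p. \<forall>u\<in>U. a u \<in> U"
    and top: "\<forall>a\<in>Lspan p. a e - \<alpha> a *s e \<in> U"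
    and W: "finite W" "\<alpha> \<in> W" and x: "x = (\<Sum>\<beta>\<in>W. xc \<beta>)"
    and xc: "\<forall>\<beta>\<in>W. xc \<beta> \<in> gen_weight_space p \<beta>" and xc_\<alpha>: "xc \<alpha> \<in> U"
  defines "V \<equiv> weight_span p U (W - {\<alpha>})"
  shows "\<forall>v\<in>V. lie_br p x v \<in> V" and "lie_br p x e - \<alpha> (Lop p x) *s e \<in> V"
proof -
  have V: "vec.subspace V" and U_V: "U \<subseteq> V"
    unfolding V_def by (rule weight_span_subspace, rule weight_span_superset)
  have R: "p v x \<in> V" for v
  proof -
    have split_x: "p v x = p v (xc \<alpha>) + (\<Sum>\<beta>\<in>W - {\<alpha>}. p v (xc \<beta>))"
      unfolding x vec.linear_sum[OF left_linear] by (rule sum.remove[OF W])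
    have "p v (xc \<alpha>) \<in> V"
      using U_inv Lop_in_Lspan[of p v] xc_\<alpha> U_V unfolding Lop_def by blast
    moreover have "(\<Sum>\<beta>\<in>W - {\<alpha>}. p v (xc \<beta>)) \<in> V"
    proof (rule vec.subspace_sum[OF V])
      fix \<beta> assume \<beta>: "\<beta> \<in> W - {\<alpha>}"
      have "\<forall>b\<in>Lspan p. \<forall>y. p v (b y) = b (p v y)"
        using Lspan_commute_Lop by simp
      then have "p v (xc \<beta>) \<in> gen_weight_space p \<beta>"
        using xc \<beta> by (intro gen_weight_space_invariant[OF left_linear]) auto
      also have "\<dots> \<subseteq> V"
        unfolding V_def using \<beta> by (rule gen_weight_space_subset_weight_span)
      finally show "p v (xc \<beta>) \<in> V" .
    qed
    ultimately show ?thesis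
      unfolding split_x by (rule vec.subspace_add[OF V])
  qed
  have x_comm: "\<forall>b\<in>Lspan p. \<forall>y. p x (b y) = b (p x y)"
    using Lspan_commute_Lop by simp
  have x_U: "\<forall>u\<in>U. p x u \<in> U"
    using U_inv Lop_in_Lspan[of p x] unfolding Lop_def by blast
  have L: "p x v \<in> V" if "v \<in> V" for v
    using that unfolding V_def by (rule weight_span_invariant[OF left_linear x_comm x_U])
  show "\<forall>v\<in>V. lie_br p x v \<in> V"
    using R L unfolding lie_br_def by (simp add: vec.subspace_diff[OF V])
  have "lie_br p x e - \<alpha> (Lop p x) *s e = (Lop p x e - \<alpha> (Lop p x) *s e) - p e x"
    unfolding lie_br_def Lop_def by simp
  also have "\<dots> \<in> V"
  proof (rule vec.subspace_diff[OF V])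
    show "Lop p x e - \<alpha> (Lop p x) *s e \<in> V"
      using top Lop_in_Lspan[of p x] U_V by blast
  qed (rule R)
  finally show "lie_br p x e - \<alpha> (Lop p x) *s e \<in> V" .
qed

end

lemma LR_algebra_left_commutative: "LR_algebra p \<Longrightarrow> left_commutative_algebra p"
  unfolding LR_algebra_def left_commutative_algebra_def by blast

subsection \<open>The theorem\<close>

theorem lemma2p2:
  fixes p :: "'k::{alg_closed_field, field_char_0}^'n \<Rightarrow> 'k^'n \<Rightarrow> 'k^'n"
    and W :: "(('k^'n \<Rightarrow> 'k^'n) \<Rightarrow> 'k) set"
    and \<alpha> :: "('k^'n \<Rightarrow> 'k^'n) \<Rightarrow> 'k"
    and e :: "nat \<Rightarrow> 'k^'n" and m :: nat
    and x :: "'k^'n" and xc :: "(('k^'n \<Rightarrow> 'k^'n) \<Rightarrow> 'k) \<Rightarrow> 'k^'n"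
  assumes LR: "LR_algebra p"
    and nilp: "nilpotent_lie p"
    \<comment> \<open>W = {alpha_1,...,alpha_s}: pairwise distinct weights whose generalized
        weight spaces decompose A\<close>
    and W_fin: "finite W"
    and W_wt: "\<forall>\<beta>\<in>W. is_weight p \<beta>"
    and W_dist: "\<forall>\<beta>\<in>W. \<forall>\<gamma>\<in>W. \<beta> \<noteq> \<gamma> \<longrightarrow> (\<exists>a\<in>Lspan p. \<beta> a \<noteq> \<gamma> a)"
    and W_dec: "\<forall>v. \<exists>c. v = (\<Sum>\<beta>\<in>W. c \<beta>) \<and> (\<forall>\<beta>\<in>W. c \<beta> \<in> gen_weight_space p \<beta>)"
    \<comment> \<open>alpha = alpha_i, with basis e_0,...,e_(m-1) of A_i (m = n_i)\<close>
    and \<alpha>W: "\<alpha> \<in> W"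
    and e_ind: "vec.independent (e ` {..<m})" and e_inj: "inj_on e {..<m}"
    and e_span: "vec.span (e ` {..<m}) = gen_weight_space p \<alpha>"
    and e_tri: "\<forall>z. \<forall>j<m. Lop p z (e j) \<in> vec.span (e ` {..j})"
    \<comment> \<open>x = x_1 + ... + x_s with x_j in A_j\<close>
    and x_dec: "x = (\<Sum>\<beta>\<in>W. xc \<beta>)"
    and xc_in: "\<forall>\<beta>\<in>W. xc \<beta> \<in> gen_weight_space p \<beta>"
    and x_i: "xc \<alpha> \<in> vec.span (e ` {..<m - 1})"
  shows "\<alpha> (Lop p x) = 0"
proof -
  interpret left_commutative_algebra p
    by (rule LR_algebra_left_commutative[OF LR])
  have m: "0 < m"
  proof (rule ccontr)
    assume "\<not> 0 < m"
    then have "gen_weight_space p \<alpha> = {0}" using e_span by simp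
    with W_wt \<alpha>W show False unfolding is_weight_def by blast
  qed
  define U where "U = vec.span (e ` {..<m - 1})"
  define V where "V = weight_span p U (W - {\<alpha>})"
  have U: "vec.subspace U" unfolding U_def by simp
  note top = last_basis_vector_weight[OF e_ind e_inj m e_span e_tri, folded U_def]
  have top_V: "e (m - 1) \<notin> V"
    unfolding V_def using W_fin W_dist \<alpha>W
    by (intro top_vector_not_in_weight_span[OF U top(2) top(1) top(3)]) auto
  have x_U: "xc \<alpha> \<in> U" using x_i unfolding U_def .
  note ad = ad_on_weight_span[where xc = xc, OF U top(2,3) W_fin \<alpha>W x_dec xc_in x_U, folded V_def]
  obtain M where M: "\<And>y. (lie_br p x ^^ M) y = 0"
    using nilpotent_ad[OF nilp] by blast
  show ?thesis
  proof (rule eigenvalue_mod_invariant_subspace[OF lie_br_linear _ ad])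
    show "vec.subspace V" unfolding V_def by (rule weight_span_subspace)
    then show "(lie_br p x ^^ M) (e (m - 1)) \<in> V" using M by (simp add: vec.subspace_0)
  qed (rule top_V)
qed

end
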